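(* Let $(G,G_1)$ be a finitely generated semigroup acting continuously on a compact metric space $X$, and assume that the action is strongly $\delta^*$-expansive for some $\delta^*>0$. Then for every continuous potential $\varphi:X\to\mathbb R$ satisfying the bounded distortion property and every $0<\varepsilon<\delta^*$, $$P_{top}((G,G_1),\varphi,X)=\limsup_{n\to\infty}\frac1n\log\Big(\frac1{m^n}\sum_{\underline g}\ \sup_E\ \sum_{x\in E}e^{S_{\underline g}\varphi(x)}\Big),$$ where the sum is over all $m^n$ concatenations $\underline g=g_{i_n}\cdots g_{i_1}$ of $n$ elements of $G_1\setminus\{id\}$ and, for each $\underline g$, the supremum is taken over all $(\underline g,n,\varepsilon)$-separated sets $E\subset X$.
   Context: Setting: $G$ is a semigroup with identity $id$ and finite generating set $G_1$ containing $id$; $m=|G_1\setminus\{id\}|$. A continuous action on $X$ assigns to every $g\in G$ a continuous map $g:X\to X$, with $id$ acting as the identity and products acting as compositions. For a concatenation $\underline g=g_{i_n}\cdots g_{i_1}$ of elements of $G_1$ put $\underline g_0=id$, $\underline g_j=g_{i_j}\cdots g_{i_1}$; $d_{\underline g}(x,y)=\max_{0\le j\le n}d(\underline g_j(x),\underline g_j(y))$; and $S_{\underline g}\varphi(x)=\sum_{i=0}^{n-1}\varphi(\underline g_i(x))$. These depend on the concatenation, not only on the resulting element of $G$. A set $E\subset X$ is $(\underline g,n,\varepsilon)$-separated if $d_{\underline g}(x,y)>\varepsilon$ for all distinct $x,y\in E$. Topological pressure: $P_{top}((G,G_1),\varphi,X)=\lim_{\varepsilon\to0}\limsup_{n\to\infty}\frac1n\log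 Z_n((G,G_1),\varphi,\varepsilon)$ with $Z_n((G,G_1),\varphi,\varepsilon)=\frac1{m^n}\sum_{\underline g}\sup_E\sum_{x\in E}e^{S_{\underline g}\varphi(x)}$, the sum over all $m^n$ concatenations of $n$ elements of $G_1\setminus\{id\}$ and the supremum over all $(\underline g,n,\varepsilon)$-separated sets $E$. Bounded distortion property: there exist $\varepsilon>0$ and $C>0$ such that for every concatenation $\underline g$ of generators, $\sup\{|S_{\underline g}\varphi(x)-S_{\underline g}\varphi(y)|:d_{\underline g}(x,y)<\varepsilon\}\le C$. Strongly $\delta^*$-expansive: for every $\gamma>0$ there is $k\ge1$ (depending on $\gamma$) such that for all $x,y\in X$ with $d(x,y)\ge\gamma$ one has $d_{\underline g}(x,y)>\delta^*$ for every concatenation $\underline g$ of $k$ elements of $G_1\setminus\{id\}$. *)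

theory Defs
  imports "HOL-Analysis.Analysis"
begin

text \<open>
  The semigroup \<open>G\<close> is the whole type \<open>'g\<close>; the space is a set \<open>X\<close> in a metric space.
\<close>

locale fg_semigroup_action =
  fixes G1 :: "'g::monoid_mult set"
    and X :: "'x::metric_space set"
    and act :: "'g \<Rightarrow> 'x \<Rightarrow> 'x"
  assumes finite_generators: "finite G1"
    and one_in_generators: "1 \<in> G1"
    and generated: "\<exists>w \<in> lists G1. prod_list w = g"
    and act_into: "x \<in> X \<Longrightarrow> act g x \<in> X"
    and act_continuous: "continuous_on X (act g)"
    and act_one: "x \<in> X \<Longrightarrow> act 1 x = x"
    and act_mult: "x \<in> X \<Longrightarrow> act (g * h) x = act g (act h x)"

text \<open>
  The concatenation \<open>g\<^bsub>i_n\<^esub> \<cdots> g\<^bsub>i_1\<^esub>\<close> is the list \<open>[g\<^bsub>i_1\<^esub>, \<dots>, g\<^bsub>i_n\<^esub>]\<close>: the head acts first.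
\<close>

definition concatenations :: "'g::monoid_mult set \<Rightarrow> nat \<Rightarrow> 'g list set" where
  "concatenations G1 n = {w. set w \<subseteq> G1 - {1} \<and> length w = n}"

definition partial :: "'g::monoid_mult list \<Rightarrow> nat \<Rightarrow> 'g" where
  "partial w j = prod_list (rev (take j w))"

definition dyn_dist ::
    "('g::monoid_mult \<Rightarrow> 'x::metric_space \<Rightarrow> 'x) \<Rightarrow> 'g list \<Rightarrow> 'x \<Rightarrow> 'x \<Rightarrow> real" where
  "dyn_dist act w x y = (MAX j\<in>{0..length w}. dist (act (partial w j) x) (act (partial w j) y))"

definition birkhoff_sum ::
    "('g::monoid_mult \<Rightarrow> 'x \<Rightarrow> 'x) \<Rightarrow> 'g list \<Rightarrow> ('x \<Rightarrow> real) \<Rightarrow> 'x \<Rightarrow> real" where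
  "birkhoff_sum act w \<phi> x = (\<Sum>i<length w. \<phi> (act (partial w i) x))"

definition separated ::
    "'x::metric_space set \<Rightarrow> ('g::monoid_mult \<Rightarrow> 'x \<Rightarrow> 'x) \<Rightarrow> 'g list \<Rightarrow> real \<Rightarrow> 'x set \<Rightarrow> bool" where
  "separated X act w \<epsilon> E \<longleftrightarrow> E \<subseteq> X \<and> pairwise (\<lambda>x y. dyn_dist act w x y > \<epsilon>) E"

text \<open>The logarithm on extended reals, with \<open>log 0 = -\<infinity>\<close> and \<open>log \<infinity> = \<infinity>\<close>.\<close>

definition ereal_ln :: "ereal \<Rightarrow> ereal" where
  "ereal_ln z = (if z \<le> 0 then -\<infinity> else if z = \<infinity> then \<infinity> else ereal (ln (real_of_ereal z)))"

text \<open>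
  For compact \<open>X\<close> and continuous maps every separated set with \<open>\<epsilon> > 0\<close> is finite, so the
  convention that a sum over an infinite set is \<open>0\<close> plays no role below.
\<close>

definition partition_sum ::
    "'g::monoid_mult set \<Rightarrow> 'x::metric_space set \<Rightarrow> ('g \<Rightarrow> 'x \<Rightarrow> 'x) \<Rightarrow> ('x \<Rightarrow> real) \<Rightarrow> real \<Rightarrow> nat \<Rightarrow> ereal"
  where
  "partition_sum G1 X act \<phi> \<epsilon> n =
     ereal (1 / real (card (G1 - {1})) ^ n) *
     (\<Sum>w\<in>concatenations G1 n.
        SUP E\<in>{E. separated X act w \<epsilon> E}. ereal (\<Sum>x\<in>E. exp (birkhoff_sum act w \<phi> x)))"

text \<open>
  The limit as \<open>\<epsilon> \<rightarrow> 0\<close> always exists in the extended reals, by monotonicity in \<open>\<epsilon>\<close>; see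
  \<open>top_pressure_tendsto\<close> below.
\<close>

definition top_pressure ::
    "'g::monoid_mult set \<Rightarrow> 'x::metric_space set \<Rightarrow> ('g \<Rightarrow> 'x \<Rightarrow> 'x) \<Rightarrow> ('x \<Rightarrow> real) \<Rightarrow> ereal" where
  "top_pressure G1 X act \<phi> =
     Lim (at_right 0) (\<lambda>\<epsilon>. limsup (\<lambda>n. ereal (1 / real n) * ereal_ln (partition_sum G1 X act \<phi> \<epsilon> n)))"

text \<open>
  The concatenations here avoid the identity. Were it allowed as a letter, the words
  \<open>[1, \<dots>, 1]\<close> would force \<open>\<phi>\<close> to be locally constant.
\<close>

definition bounded_distortion ::
    "'g::monoid_mult set \<Rightarrow> 'x::metric_space set \<Rightarrow> ('g \<Rightarrow> 'x \<Rightarrow> 'x) \<Rightarrow> ('x \<Rightarrow> real) \<Rightarrow> bool" where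
  "bounded_distortion G1 X act \<phi> \<longleftrightarrow>
     (\<exists>\<epsilon>>0. \<exists>C>0. \<forall>n. \<forall>w\<in>concatenations G1 n.
        (SUP (x, y)\<in>{(x, y). x \<in> X \<and> y \<in> X \<and> dyn_dist act w x y < \<epsilon>}.
           ereal \<bar>birkhoff_sum act w \<phi> x - birkhoff_sum act w \<phi> y\<bar>) \<le> ereal C)"

definition strongly_expansive ::
    "'g::monoid_mult set \<Rightarrow> 'x::metric_space set \<Rightarrow> ('g \<Rightarrow> 'x \<Rightarrow> 'x) \<Rightarrow> real \<Rightarrow> bool" where
  "strongly_expansive G1 X act \<delta> \<longleftrightarrow>
     (\<forall>\<gamma>>0. \<exists>k\<ge>1. \<forall>x\<in>X. \<forall>y\<in>X. dist x y \<ge> \<gamma> \<longrightarrow>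
        (\<forall>w\<in>concatenations G1 k. dyn_dist act w x y > \<delta>))"

lemma ereal_ln_mono: "a \<le> b \<Longrightarrow> ereal_ln a \<le> ereal_ln b"
  by (cases a; cases b) (auto simp: ereal_ln_def zero_ereal_def)

lemma partition_sum_antimono:
  assumes "\<epsilon> \<le> \<epsilon>'"
  shows "partition_sum G1 X act \<phi> \<epsilon>' n \<le> partition_sum G1 X act \<phi> \<epsilon> n"
  unfolding partition_sum_def
proof (intro ereal_mult_left_mono sum_mono SUP_subset_mono)
  show "{E. separated X act w \<epsilon>' E} \<subseteq> {E. separated X act w \<epsilon> E}" for w
    using assms by (force simp: separated_def pairwise_def)
qed auto

lemma top_pressure_tendsto:
  "((\<lambda>\<epsilon>. limsup (\<lambda>n. ereal (1 / real n) * ereal_ln (partition_sum G1 X act \<phi> \<epsilon> n)))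
     \<longlongrightarrow> top_pressure G1 X act \<phi>) (at_right 0)"
proof -
  define F where
    "F = (\<lambda>\<epsilon>. limsup (\<lambda>n. ereal (1 / real n) * ereal_ln (partition_sum G1 X act \<phi> \<epsilon> n)))"
  have anti: "F \<epsilon>' \<le> F \<epsilon>" if "\<epsilon> \<le> \<epsilon>'" for \<epsilon> \<epsilon>'
    unfolding F_def using that
    by (intro Limsup_mono always_eventually allI ereal_mult_left_mono ereal_ln_mono
        partition_sum_antimono) auto
  have "(F \<longlongrightarrow> (SUP \<epsilon>\<in>{0<..}. F \<epsilon>)) (at_right 0)"
  proof (rule increasing_tendsto)
    show "\<forall>\<^sub>F \<epsilon> in at_right 0. F \<epsilon> \<le> (SUP \<epsilon>\<in>{0<..}. F \<epsilon>)"
      by (auto simp: eventually_at_right_field intro!: exI[of _ 1] SUP_upper)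
  next
    fix a assume "a < (SUP \<epsilon>\<in>{0<..}. F \<epsilon>)"
    then obtain \<epsilon> where "\<epsilon> > 0" "a < F \<epsilon>"
      by (auto simp: less_SUP_iff)
    then show "\<forall>\<^sub>F \<epsilon> in at_right 0. a < F \<epsilon>"
      using anti by (auto simp: eventually_at_right_field intro!: exI[of _ \<epsilon>] intro: less_le_trans)
  qed
  then show ?thesis
    unfolding top_pressure_def F_def [symmetric]
    by (simp add: tendsto_Lim)
qed

end

theory Submission
  imports Defs
begin

text \<open>
  Let \<open>w\<close> be a word of length \<open>n\<close> and \<open>k\<close> the expansivity time of the scale \<open>\<gamma>\<close>. If two orbits
  are more than \<open>\<gamma>\<close> apart at some time \<open>j \<le> n\<close>, then the next \<open>k\<close> letters of any
  prolongation \<open>w @ u\<close> with \<open>length u = k\<close> drive them more than \<open>\<delta>\<close> apart. So a \<open>\<gamma>\<close>-separated set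
  for \<open>w\<close> is \<open>\<delta>\<close>-separated for \<open>w @ u\<close>, while the Birkhoff sums change by at most
  \<open>k * sup \<bar>\<phi>\<bar>\<close>. Averaging over all \<open>u\<close> bounds the partition sum of scale \<open>\<gamma>\<close> at time \<open>n\<close> by a
  constant times that of any scale \<open>\<epsilon> < \<delta>\<close> at time \<open>n + k\<close>. Hence the growth rate does not
  depend on the scale below \<open>\<delta>\<close>.
\<close>

text \<open>The head of a list acts first, so later letters multiply on the left: the window of
  \<open>k\<close> letters after time \<open>j\<close> continues each orbit from its point at time
  \<open>j\<close>.\<close>

lemma partial_add: "partial (take k (drop j w)) i * partial w j = partial w (j + i)" if "i \<le> k"
  using that by (simp add: partial_def take_add min_absorb1)

lemma partial_append: "j \<le> length w \<Longrightarrow> partial (w @ u) j = partial w j"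
  by (simp add: partial_def)

lemma less_dyn_dist_iff:
  "r < dyn_dist act w x y \<longleftrightarrow> (\<exists>j\<le>length w. r < dist (act (partial w j) x) (act (partial w j) y))"
  unfolding dyn_dist_def by (subst Max_gr_iff) auto

lemma take_drop_in_concatenations:
  assumes "w \<in> concatenations G1 n" "j + k \<le> n"
  shows "take k (drop j w) \<in> concatenations G1 k"
  using assms by (auto simp: concatenations_def dest: in_set_takeD in_set_dropD)

lemma append_in_concatenations:
  "w \<in> concatenations G1 n \<Longrightarrow> u \<in> concatenations G1 k \<Longrightarrow> w @ u \<in> concatenations G1 (n + k)"
  by (auto simp: concatenations_def)

text \<open>Cutting a word after its first \<open>n\<close> letters inverts the concatenation of
  pairs.\<close>

lemma sum_concatenations_add:
  fixes f :: "'g::monoid_mult list \<Rightarrow> 'a::comm_monoid_add"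
  shows "(\<Sum>w\<in>concatenations G1 (n + k). f w)
    = (\<Sum>w\<in>concatenations G1 n. \<Sum>u\<in>concatenations G1 k. f (w @ u))"
proof -
  have "(\<Sum>w\<in>concatenations G1 (n + k). f w)
      = (\<Sum>(w, u)\<in>concatenations G1 n \<times> concatenations G1 k. f (w @ u))"
    by (rule sum.reindex_bij_witness[where i = "\<lambda>(w, u). w @ u" and j = "\<lambda>w. (take n w, drop n w)"])
      (auto simp: concatenations_def dest: in_set_takeD in_set_dropD)
  then show ?thesis by (simp add: sum.cartesian_product)
qed

lemma card_concatenations: "finite G1 \<Longrightarrow> card (concatenations G1 n) = card (G1 - {1}) ^ n"
  unfolding concatenations_def by (rule card_lists_length_eq) simp

lemma separated_append:
  assumes action: "fg_semigroup_action G1 X act"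
    and k: "\<And>x y v. x \<in> X \<Longrightarrow> y \<in> X \<Longrightarrow> \<gamma> \<le> dist x y \<Longrightarrow> v \<in> concatenations G1 k
      \<Longrightarrow> \<delta> < dyn_dist act v x y"
    and w: "w \<in> concatenations G1 n" and u: "u \<in> concatenations G1 k"
    and sep: "separated X act w \<gamma> E"
  shows "separated X act (w @ u) \<delta> E"
  unfolding separated_def pairwise_def
proof (intro conjI ballI impI)
  interpret fg_semigroup_action G1 X act by fact
  show E: "E \<subseteq> X" using sep by (simp add: separated_def)
  fix x y assume "x \<in> E" "y \<in> E" "x \<noteq> y"
  then have xy: "x \<in> X" "y \<in> X" and "\<gamma> < dyn_dist act w x y"
    using E sep by (auto simp: separated_def pairwise_def)
  then obtain j where j: "j \<le> n"
      and far: "\<gamma> < dist (act (partial w j) x) (act (partial w j) y)"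
    using w by (auto simp: less_dyn_dist_iff concatenations_def)
  define p where "p = partial (w @ u) j"
  \<comment> \<open>Since \<open>j \<le> n\<close>, at least \<open>k\<close> letters of
    \<open>w @ u\<close> remain after time \<open>j\<close>, even for \<open>j = n\<close>; the
    window therefore has full length \<open>k\<close>.\<close>
  define v where "v = take k (drop j (w @ u))"
  have v: "v \<in> concatenations G1 k"
    unfolding v_def
    using append_in_concatenations[OF w u] j by (intro take_drop_in_concatenations) auto
  have "p = partial w j"
    using j w by (simp add: p_def partial_append concatenations_def)
  then have "\<gamma> \<le> dist (act p x) (act p y)"
    using far by simp
  then have "\<delta> < dyn_dist act v (act p x) (act p y)"
    using xy v by (intro k act_into)
  then obtain i where i: "i \<le> k"
      and "\<delta> < dist (act (partial v i) (act p x)) (act (partial v i) (act p y))"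
    using v by (auto simp: less_dyn_dist_iff concatenations_def)
  moreover have "act (partial v i) (act p z) = act (partial (w @ u) (j + i)) z" if "z \<in> X" for z
    using act_mult[OF that, of "partial v i" p] partial_add[OF i, of j "w @ u"]
    by (simp add: p_def v_def)
  ultimately show "\<delta> < dyn_dist act (w @ u) x y"
    using xy j w u by (auto simp: less_dyn_dist_iff concatenations_def intro!: exI[of _ "j + i"])
qed

text \<open>Prolonging \<open>w\<close> keeps the old terms and adds \<open>length u\<close> new
  ones, each at least \<open>- M\<close>.\<close>

lemma birkhoff_sum_append_ge:
  assumes action: "fg_semigroup_action G1 X act"
    and M: "\<And>x. x \<in> X \<Longrightarrow> \<bar>\<phi> x\<bar> \<le> M" and x: "x \<in> X"
  shows "birkhoff_sum act w \<phi> x \<le> real (length u) * M + birkhoff_sum act (w @ u) \<phi> x"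
proof -
  interpret fg_semigroup_action G1 X act by fact
  let ?f = "\<lambda>i. \<phi> (act (partial (w @ u) i) x)"
  have "(\<Sum>i<length w + l. ?f i) = (\<Sum>i<length w. ?f i) + (\<Sum>i<l. ?f (length w + i))" for l
    by (induction l) simp_all
  then have "birkhoff_sum act (w @ u) \<phi> x = (\<Sum>i<length w. ?f i) + (\<Sum>i<length u. ?f (length w + i))"
    by (simp add: birkhoff_sum_def)
  moreover have "(\<Sum>i<length w. ?f i) = birkhoff_sum act w \<phi> x"
    by (simp add: birkhoff_sum_def partial_append)
  moreover have "(\<Sum>i<length u. - M) \<le> (\<Sum>i<length u. ?f (length w + i))"
    using M[OF act_into[OF x]] by (intro sum_mono) (metis abs_le_D2 minus_le_iff)
  ultimately show ?thesis by simp
qed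

text \<open>The same set \<open>E\<close> competes in both suprema, because
  \<open>\<delta>\<close>-separation for \<open>w @ u\<close> implies
  \<open>\<epsilon>\<close>-separation. The factor pays for the \<open>k\<close> extra terms of the
  Birkhoff sum.\<close>

lemma SUP_separated_append_le:
  assumes action: "fg_semigroup_action G1 X act"
    and k: "\<And>x y v. x \<in> X \<Longrightarrow> y \<in> X \<Longrightarrow> \<gamma> \<le> dist x y \<Longrightarrow> v \<in> concatenations G1 k
      \<Longrightarrow> \<delta> < dyn_dist act v x y"
    and M: "\<And>x. x \<in> X \<Longrightarrow> \<bar>\<phi> x\<bar> \<le> M" and "\<epsilon> < \<delta>"
    and w: "w \<in> concatenations G1 n" and u: "u \<in> concatenations G1 k"
  shows "(SUP E\<in>{E. separated X act w \<gamma> E}. ereal (\<Sum>x\<in>E. exp (birkhoff_sum act w \<phi> x)))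
    \<le> ereal (exp (k * M)) *
      (SUP E\<in>{E. separated X act (w @ u) \<epsilon> E}. ereal (\<Sum>x\<in>E. exp (birkhoff_sum act (w @ u) \<phi> x)))"
proof (rule SUP_least)
  fix E assume "E \<in> {E. separated X act w \<gamma> E}"
  then have sep: "separated X act w \<gamma> E" by simp
  have E: "E \<subseteq> X" using sep by (simp add: separated_def)
  have sep': "separated X act (w @ u) \<epsilon> E"
    using separated_append[OF action k w u sep] \<open>\<epsilon> < \<delta>\<close>
    by (auto simp: separated_def pairwise_def intro: less_trans)
  have "exp (birkhoff_sum act w \<phi> x) \<le> exp (k * M) * exp (birkhoff_sum act (w @ u) \<phi> x)"
    if "x \<in> E" for x
    using birkhoff_sum_append_ge[where u = u and w = w, OF action M] E that u
    by (auto simp flip: exp_add simp: concatenations_def)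
  \<comment> \<open>For infinite \<open>E\<close> both sums are 0 by convention, so the inequality
    covers every \<open>E\<close>.\<close>
  then have "ereal (\<Sum>x\<in>E. exp (birkhoff_sum act w \<phi> x))
      \<le> ereal (exp (k * M)) * ereal (\<Sum>x\<in>E. exp (birkhoff_sum act (w @ u) \<phi> x))"
    by (auto simp: sum_distrib_left intro: sum_mono)
  also have "\<dots> \<le> ereal (exp (k * M)) *
      (SUP E\<in>{E. separated X act (w @ u) \<epsilon> E}. ereal (\<Sum>x\<in>E. exp (birkhoff_sum act (w @ u) \<phi> x)))"
    using sep' by (intro ereal_mult_left_mono SUP_upper) auto
  finally show "ereal (\<Sum>x\<in>E. exp (birkhoff_sum act w \<phi> x)) \<le> \<dots>" .
qed

text \<open>With \<open>m\<close> letters available, each word has \<open>m ^ k\<close>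
  prolongations; this count cancels the change of normalisation from \<open>m ^ n\<close> to
  \<open>m ^ (n + k)\<close>.\<close>

lemma partition_sum_shift_le:
  assumes action: "fg_semigroup_action G1 X act"
    and k: "\<And>x y v. x \<in> X \<Longrightarrow> y \<in> X \<Longrightarrow> \<gamma> \<le> dist x y \<Longrightarrow> v \<in> concatenations G1 k
      \<Longrightarrow> \<delta> < dyn_dist act v x y"
    and M: "\<And>x. x \<in> X \<Longrightarrow> \<bar>\<phi> x\<bar> \<le> M" and "\<epsilon> < \<delta>" and "0 < n"
  shows "partition_sum G1 X act \<phi> \<gamma> n \<le> ereal (exp (k * M)) * partition_sum G1 X act \<phi> \<epsilon> (n + k)"
proof -
  interpret fg_semigroup_action G1 X act by fact
  define m where "m = card (G1 - {1})"
  define S where "S r w = (SUP E\<in>{E. separated X act w r E}.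
      ereal (\<Sum>x\<in>E. exp (birkhoff_sum act w \<phi> x)))" for r w
  \<comment> \<open>The empty set is separated and contributes 0. Nonnegativity lets constants be
    moved through sums of extended reals.\<close>
  have S_nonneg: "0 \<le> S r w" for r w
    unfolding S_def by (rule SUP_upper2[of "{}"]) (auto simp: separated_def)
  have Z: "partition_sum G1 X act \<phi> r n = ereal (1 / real m ^ n) * (\<Sum>w\<in>concatenations G1 n. S r w)"
    for r n by (simp add: partition_sum_def S_def m_def)
  have sum_nonneg': "0 \<le> (\<Sum>w\<in>A. S r w)" for r A
    using S_nonneg by (rule sum_nonneg)
  show ?thesis
  proof (cases "m = 0")
    case True
    \<comment> \<open>Without letters, \<open>1 / 0 ^ n = 0\<close> for \<open>n > 0\<close>, so
      both sides vanish; at \<open>n = 0\<close> the left side would still count the empty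
      word.\<close>
    then show ?thesis
      using \<open>0 < n\<close> by (simp add: Z zero_ereal_def[symmetric] power_0_left)
  next
    case False
    have step: "ereal (real m ^ k) * S \<gamma> w \<le> (\<Sum>u\<in>concatenations G1 k. ereal (exp (k * M)) * S \<epsilon> (w @ u))"
      if "w \<in> concatenations G1 n" for w
    proof -
      have "ereal (real m ^ k) * S \<gamma> w = (\<Sum>u\<in>concatenations G1 k. S \<gamma> w)"
        by (simp add: sum_constant_ereal card_concatenations finite_generators m_def mult.commute)
      also have "\<dots> \<le> (\<Sum>u\<in>concatenations G1 k. ereal (exp (k * M)) * S \<epsilon> (w @ u))"
        unfolding S_def
        by (intro sum_mono SUP_separated_append_le[OF action k M \<open>\<epsilon> < \<delta>\<close> that])
      finally show ?thesis .
    qed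
    have "ereal (real m ^ k) * (\<Sum>w\<in>concatenations G1 n. S \<gamma> w)
        = (\<Sum>w\<in>concatenations G1 n. ereal (real m ^ k) * S \<gamma> w)"
      by (simp add: sum_ereal_right_distrib S_nonneg)
    also have "\<dots> \<le> (\<Sum>w\<in>concatenations G1 n. \<Sum>u\<in>concatenations G1 k. ereal (exp (k * M)) * S \<epsilon> (w @ u))"
      by (intro sum_mono step)
    also have "\<dots> = (\<Sum>w\<in>concatenations G1 (n + k). ereal (exp (k * M)) * S \<epsilon> w)"
      by (rule sum_concatenations_add[symmetric])
    also have "\<dots> = ereal (exp (k * M)) * (\<Sum>w\<in>concatenations G1 (n + k). S \<epsilon> w)"
      by (simp add: sum_ereal_right_distrib S_nonneg)
    finally have "ereal (1 / real m ^ (n + k)) * (ereal (real m ^ k) * (\<Sum>w\<in>concatenations G1 n. S \<gamma> w))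
        \<le> ereal (1 / real m ^ (n + k)) * (ereal (exp (k * M)) * (\<Sum>w\<in>concatenations G1 (n + k). S \<epsilon> w))"
      by (intro ereal_mult_left_mono) auto
    moreover have "ereal (1 / real m ^ (n + k)) * ereal (real m ^ k) = ereal (1 / real m ^ n)"
      using False by (simp add: power_add)
    ultimately show ?thesis
      by (simp add: Z mult.assoc[symmetric] mult.commute)
  qed
qed

lemma ereal_ln_mult: "0 < c \<Longrightarrow> ereal_ln (ereal c * z) = ereal (ln c) + ereal_ln z"
  by (cases z) (auto simp: ereal_ln_def zero_ereal_def ln_mult mult_le_0_iff)

text \<open>After division by \<open>n\<close> the constant \<open>c\<close> disappears in the
  limit, and the shift of the index costs only the factor \<open>(n + k) / n\<close>, which tends to
  1.\<close>

lemma limsup_ereal_ln_shift_le: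
  fixes a b :: "nat \<Rightarrow> ereal"
  assumes "\<And>n. 0 < n \<Longrightarrow> a n \<le> ereal (exp c) * b (n + k)"
  shows "limsup (\<lambda>n. ereal (1 / real n) * ereal_ln (a n))
    \<le> limsup (\<lambda>n. ereal (1 / real n) * ereal_ln (b n))"
proof -
  define f where "f n = ereal (1 / real n) * ereal_ln (b n)" for n
  have "limsup (\<lambda>n. ereal (1 / real n) * ereal_ln (a n))
      \<le> limsup (\<lambda>n. ereal (c / real n) + ereal (real (n + k) / real n) * f (n + k))"
  proof (rule Limsup_mono, rule eventually_mono[OF eventually_gt_at_top[of 0]])
    fix n :: nat assume n: "0 < n"
    have "ereal (1 / real n) * ereal_ln (a n) \<le> ereal (1 / real n) * (ereal c + ereal_ln (b (n + k)))"
      using ereal_ln_mono[OF assms[OF n]] by (intro ereal_mult_left_mono) (auto simp: ereal_ln_mult)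
    \<comment> \<open>The logarithm may be infinite, but \<open>c\<close> is finite, so no
      difference of infinities arises.\<close>
    also have "\<dots> = ereal (c / real n) + ereal (1 / real n) * ereal_ln (b (n + k))"
      by (cases "ereal_ln (b (n + k))") (use n in \<open>auto simp: add_divide_distrib\<close>)
    also have "ereal (1 / real n) * ereal_ln (b (n + k)) = ereal (real (n + k) / real n) * f (n + k)"
      using n by (simp add: f_def flip: mult.assoc)
    finally show "ereal (1 / real n) * ereal_ln (a n)
        \<le> ereal (c / real n) + ereal (real (n + k) / real n) * f (n + k)" .
  qed
  \<comment> \<open>The limits 0 of the summand and 1 of the factor are finite, and the latter is
    positive, so both split off even from an infinite limsup.\<close>
  also have "\<dots> = 0 + limsup (\<lambda>n. ereal (real (n + k) / real n) * f (n + k))"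
    by (rule ereal_limsup_lim_add) (auto simp: zero_ereal_def intro!: lim_const_over_n)
  also have "limsup (\<lambda>n. ereal (real (n + k) / real n) * f (n + k)) = 1 * limsup (\<lambda>n. f (n + k))"
  proof (rule ereal_limsup_lim_mult)
    have "(\<lambda>n. 1 + real k / real n) \<longlonglongrightarrow> 1 + 0"
      by (intro tendsto_add tendsto_const lim_const_over_n)
    moreover have "\<forall>\<^sub>F n in sequentially. 1 + real k / real n = real (n + k) / real n"
      using eventually_gt_at_top[of 0] by eventually_elim (simp add: field_simps)
    ultimately have "(\<lambda>n. real (n + k) / real n) \<longlonglongrightarrow> 1"
      by (simp add: tendsto_cong)
    then show "(\<lambda>n. ereal (real (n + k) / real n)) \<longlonglongrightarrow> 1"
      by (simp add: one_ereal_def)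
  qed auto
  also have "limsup (\<lambda>n. f (n + k)) = limsup f"
    by (rule limsup_shift_k)
  finally show ?thesis by (simp add: f_def[abs_def])
qed

theorem theorem4p5:
  fixes G1 :: "'g::monoid_mult set"
    and X :: "'x::metric_space set"
    and act :: "'g \<Rightarrow> 'x \<Rightarrow> 'x"
    and \<phi> :: "'x \<Rightarrow> real"
    and \<delta> \<epsilon> :: real
  assumes "fg_semigroup_action G1 X act"
    and "compact X"
    and "\<delta> > 0"
    and "strongly_expansive G1 X act \<delta>"
    and "continuous_on X \<phi>"
    and "bounded_distortion G1 X act \<phi>"
    and "0 < \<epsilon>" and "\<epsilon> < \<delta>"
  shows "top_pressure G1 X act \<phi> =
    limsup (\<lambda>n. ereal (1 / real n) *
      ereal_ln (ereal (1 / real (card (G1 - {1})) ^ n) *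
        (\<Sum>w\<in>concatenations G1 n.
          SUP E\<in>{E. separated X act w \<epsilon> E}. ereal (\<Sum>x\<in>E. exp (birkhoff_sum act w \<phi> x)))))"
proof -
  define F where
    "F r = limsup (\<lambda>n. ereal (1 / real n) * ereal_ln (partition_sum G1 X act \<phi> r n))" for r
  have "bounded (\<phi> ` X)"
    using assms(2,5) by (intro compact_imp_bounded compact_continuous_image)
  then obtain M where M: "\<And>x. x \<in> X \<Longrightarrow> \<bar>\<phi> x\<bar> \<le> M"
    by (auto simp: bounded_iff)
  \<comment> \<open>The time \<open>k\<close> depends on \<open>\<gamma>\<close>, but it enters only
    through the constant \<open>k * M\<close> and the index shift, neither of which affects the
    growth rate.\<close>
  have "F \<gamma> = F \<epsilon>" if \<gamma>: "0 < \<gamma>" "\<gamma> < \<epsilon>" for \<gamma>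
  proof (rule antisym)
    from assms(4) \<gamma>(1) obtain k where k: "\<And>x y v. x \<in> X \<Longrightarrow> y \<in> X \<Longrightarrow> \<gamma> \<le> dist x y
        \<Longrightarrow> v \<in> concatenations G1 k \<Longrightarrow> \<delta> < dyn_dist act v x y"
      unfolding strongly_expansive_def by metis
    show "F \<gamma> \<le> F \<epsilon>"
      unfolding F_def
      by (rule limsup_ereal_ln_shift_le, rule partition_sum_shift_le[OF assms(1) k M assms(8)])
    show "F \<epsilon> \<le> F \<gamma>"
      unfolding F_def using \<gamma>(2)
      by (intro Limsup_mono always_eventually allI ereal_mult_left_mono ereal_ln_mono
          partition_sum_antimono) auto
  qed
  \<comment> \<open>\<open>F\<close> is constant on \<open>(0, \<epsilon>)\<close> with value
    \<open>F \<epsilon>\<close>, so its limit at 0, which is the pressure, is already attained at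
    scale \<open>\<epsilon>\<close>.\<close>
  then have "\<forall>\<^sub>F \<gamma> in at_right 0. F \<gamma> = F \<epsilon>"
    using assms(7) by (auto simp: eventually_at_right_field)
  then have "(F \<longlongrightarrow> F \<epsilon>) (at_right 0)"
    by (rule tendsto_eventually)
  moreover have "(F \<longlongrightarrow> top_pressure G1 X act \<phi>) (at_right 0)"
    unfolding F_def by (rule top_pressure_tendsto)
  ultimately have "top_pressure G1 X act \<phi> = F \<epsilon>"
    by (intro tendsto_unique[OF trivial_limit_at_right_real])
  then show ?thesis
    by (simp add: F_def partition_sum_def)
qed

end
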